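(* Let $p\ge 2$ be an integer and let $k,m$ be non-negative integers with $k\ge m-1$. Let $P_{km}/Q_{km}$ be the $[k/m]$ Padé approximant of $(1-z)^{-1/p}$, and let $x_0\in\mathbb{C}$ satisfy $|1-x_0^p|<1$. Let $(x_l)_{l\ge 0}$ be the sequence generated by $$x_{l+1}=x_l\,\frac{P_{km}(1-x_l^p)}{Q_{km}(1-x_l^p)},\qquad l\ge 0.$$ Then for every integer $l\ge 0$, $$|1-x_l^p|\le |1-x_0^p|^{(k+m+1)^l}.$$
   Context: Pochhammer symbol: $(\alpha)_0=1$ and $(\alpha)_j=\alpha(\alpha+1)\cdots(\alpha+j-1)$ for $j\ge 1$. The numerator and denominator of the $[k/m]$ Padé approximant of $(1-z)^{-1/p}$ are the polynomials $$P_{km}(z)=\sum_{j=0}^{k}\frac{(-k)_j\left(\frac1p-m\right)_j}{j!\,(-k-m)_j}z^j,\qquad Q_{km}(z)=\sum_{j=0}^{m}\frac{(-m)_j\left(-\frac1p-k\right)_j}{j!\,(-k-m)_j}z^j .$$ *)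

theory Defs
  imports Complex_Main "HOL-Computational_Algebra.Polynomial"
begin

text \<open>
  Numerator and denominator of the \<open>[k/m]\<close> Pade approximant of \<open>(1 - z)\<close> to the power \<open>-1/p\<close>,
  normalised to have constant coefficient 1. The factor \<open>pochhammer (-k-m) j\<close> is
  non-zero for all \<open>j \<le> k + m\<close>, so no coefficient below is a division by zero.
\<close>

definition pade_num :: "nat \<Rightarrow> nat \<Rightarrow> nat \<Rightarrow> complex poly" where
  "pade_num p k m =
     (\<Sum>j\<le>k. monom (pochhammer (- of_nat k) j * pochhammer (1 / of_nat p - of_nat m) j
               / (fact j * pochhammer (- of_nat k - of_nat m) j)) j)"

definition pade_den :: "nat \<Rightarrow> nat \<Rightarrow> nat \<Rightarrow> complex poly" where
  "pade_den p k m =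
     (\<Sum>j\<le>m. monom (pochhammer (- of_nat m) j * pochhammer (- 1 / of_nat p - of_nat k) j
               / (fact j * pochhammer (- of_nat k - of_nat m) j)) j)"

end

theory Submission
  imports Defs "HOL-Computational_Algebra.Formal_Power_Series"
begin

text \<open>
  Put \<open>a = 1/p\<close>, \<open>R = P/Q\<close> and \<open>F z = 1 - (1 - z) * R z ^ p\<close>, so that one step of the iteration maps
  the residual \<open>z = 1 - x ^ p\<close> to \<open>F z\<close>. The polynomial \<open>a P Q - (1 - z) (P' Q - P Q')\<close> has degree at
  most \<open>k + m\<close> and, by the order of the Pade approximation, is divisible by \<open>z ^ (k + m)\<close>. Hence
  \<open>F' = C * z ^ (k + m) * R ^ (p - 1) / Q\<^sup>2\<close> for a constant \<open>C\<close>. For \<open>k \<ge> m - 1\<close> the power series of \<open>R\<close>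
  and \<open>1/Q\<close> have nonnegative coefficients that are summable on the closed disc, so all coefficients
  of \<open>F\<close> have the sign of \<open>C\<close>. They add up to \<open>F 1 = 1\<close>; they are therefore nonnegative, start at
  index \<open>k + m + 1\<close>, and \<open>\<bar>F z\<bar> \<le> \<bar>z\<bar> ^ (k + m + 1)\<close> on the disc.

  Nonnegativity comes from the contiguous relations
  \<open>Q (k+1) (m+1) = Q k (m+1) - c z Q k m\<close> and \<open>Q (k+1) (m+1) = Q (k+1) m - c' z Q k m\<close> with
  \<open>c, c' \<ge> 0\<close>: they express ratios of neighbouring denominators as \<open>1 / (1 - c z V)\<close> with \<open>V\<close> an
  earlier ratio, and \<open>P\<close> satisfies the same relations, which makes
  the difference of neighbouring \<open>R\<close>'s a nonnegative multiple of a power of \<open>z\<close> over a product of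
  two \<open>Q\<close>'s.
\<close>

section \<open>Power series with absolutely summable coefficients\<close>

definition abs_summable_fps :: "real fps \<Rightarrow> bool" where
  "abs_summable_fps f \<longleftrightarrow> summable (\<lambda>n. \<bar>fps_nth f n\<bar>)"

text \<open>The argument type stays general because one real series is evaluated both at the real
  point 1, giving the sum of its coefficients, and at complex points of the closed disc.\<close>

definition eval_disc :: "real fps \<Rightarrow> 'a::{real_normed_field,banach} \<Rightarrow> 'a" where
  "eval_disc f z = (\<Sum>n. of_real (fps_nth f n) * z ^ n)"

lemma summable_norm_eval_disc:
  fixes z :: "'a::{real_normed_field,banach}"
  assumes "abs_summable_fps f" "norm z \<le> 1"
  shows "summable (\<lambda>n. norm (of_real (fps_nth f n) * z ^ n))"
proof (rule summable_comparison_test')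
  show "summable (\<lambda>n. \<bar>fps_nth f n\<bar>)" using assms by (simp add: abs_summable_fps_def)
  fix n show "norm (norm (of_real (fps_nth f n) * z ^ n)) \<le> \<bar>fps_nth f n\<bar>"
    using assms by (simp add: norm_mult norm_power mult_left_le power_le_one)
qed

lemma eval_disc_sums:
  fixes z :: "'a::{real_normed_field,banach}"
  assumes "abs_summable_fps f" "norm z \<le> 1"
  shows "(\<lambda>n. of_real (fps_nth f n) * z ^ n) sums eval_disc f z"
  unfolding eval_disc_def
  by (intro summable_sums summable_norm_cancel[OF summable_norm_eval_disc] assms)

lemma abs_summable_fps_poly:
  "(\<And>n. N < n \<Longrightarrow> fps_nth f n = 0) \<Longrightarrow> abs_summable_fps f"
  unfolding abs_summable_fps_def by (rule summable_finite[of "{..N}"]) (auto simp: not_le)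

lemma eval_disc_eq_sum:
  "(\<And>n. N < n \<Longrightarrow> fps_nth f n = 0) \<Longrightarrow>
    eval_disc f z = (\<Sum>n\<le>N. of_real (fps_nth f n) * z ^ n)"
  unfolding eval_disc_def by (rule suminf_finite) (auto simp: not_le)

lemma abs_summable_fps_const [simp]: "abs_summable_fps (fps_const c)"
  and eval_disc_const [simp]: "eval_disc (fps_const c) z = of_real c"
  using abs_summable_fps_poly[of 0 "fps_const c"] eval_disc_eq_sum[of 0 "fps_const c" z] by simp_all

lemma abs_summable_fps_1 [simp]: "abs_summable_fps 1"
  and eval_disc_1 [simp]: "eval_disc 1 z = 1"
  using abs_summable_fps_poly[of 0 1] eval_disc_eq_sum[of 0 1 z] by simp_all

lemma abs_summable_fps_X [simp]: "abs_summable_fps fps_X"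
  and eval_disc_X [simp]: "eval_disc fps_X z = z"
  using abs_summable_fps_poly[of 1 fps_X] eval_disc_eq_sum[of 1 fps_X z] by simp_all

lemma abs_summable_fps_diff [simp]:
  "abs_summable_fps f \<Longrightarrow> abs_summable_fps g \<Longrightarrow> abs_summable_fps (f - g)"
  unfolding abs_summable_fps_def
  by (rule summable_comparison_test'[where N = 0, OF summable_add[of "\<lambda>n. \<bar>fps_nth f n\<bar>" "\<lambda>n. \<bar>fps_nth g n\<bar>"]])
    auto

lemma eval_disc_diff:
  fixes z :: "'a::{real_normed_field,banach}"
  assumes "abs_summable_fps f" "abs_summable_fps g" "norm z \<le> 1"
  shows "eval_disc (f - g) z = eval_disc f z - eval_disc g z"
proof -
  have "(\<lambda>n. of_real (fps_nth (f - g) n) * z ^ n) sums (eval_disc f z - eval_disc g z)"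
    using sums_diff[OF eval_disc_sums[OF assms(1,3)] eval_disc_sums[OF assms(2,3)]]
    by (simp add: algebra_simps)
  then show ?thesis by (simp add: eval_disc_def sums_iff)
qed

lemma abs_summable_fps_mult [simp]:
  assumes "abs_summable_fps f" "abs_summable_fps g"
  shows "abs_summable_fps (f * g)"
  unfolding abs_summable_fps_def
proof (rule summable_comparison_test')
  show "summable (\<lambda>n. \<Sum>i\<le>n. \<bar>fps_nth f i\<bar> * \<bar>fps_nth g (n - i)\<bar>)"
    using assms unfolding abs_summable_fps_def by (intro summable_Cauchy_product) simp_all
  fix n show "norm \<bar>fps_nth (f * g) n\<bar> \<le> (\<Sum>i\<le>n. \<bar>fps_nth f i\<bar> * \<bar>fps_nth g (n - i)\<bar>)"
    by (simp add: fps_mult_nth atLeast0AtMost) (simp flip: abs_mult)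
qed

lemma eval_disc_mult:
  fixes z :: "'a::{real_normed_field,banach}"
  assumes "abs_summable_fps f" "abs_summable_fps g" "norm z \<le> 1"
  shows "eval_disc (f * g) z = eval_disc f z * eval_disc g z"
proof -
  have "(\<lambda>n. \<Sum>i\<le>n. (of_real (fps_nth f i) * z ^ i) * (of_real (fps_nth g (n - i)) * z ^ (n - i)))
      sums (eval_disc f z * eval_disc g z)"
    unfolding eval_disc_def using assms by (intro Cauchy_product_sums summable_norm_eval_disc)
  moreover have "(\<Sum>i\<le>n. (of_real (fps_nth f i) * z ^ i) * (of_real (fps_nth g (n - i)) * z ^ (n - i)))
      = of_real (fps_nth (f * g) n) * z ^ n" for n
    unfolding fps_mult_nth atLeast0AtMost of_real_sum sum_distrib_right
  proof (intro sum.cong refl)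
    fix i assume "i \<in> {..n}"
    then have "z ^ n = z ^ i * z ^ (n - i)" by (simp flip: power_add)
    then show "(of_real (fps_nth f i) * z ^ i) * (of_real (fps_nth g (n - i)) * z ^ (n - i))
        = of_real (fps_nth f i * fps_nth g (n - i)) * z ^ n" by (simp add: ac_simps)
  qed
  ultimately show ?thesis by (simp add: eval_disc_def sums_iff)
qed

lemma abs_summable_fps_power [simp]: "abs_summable_fps f \<Longrightarrow> abs_summable_fps (f ^ n)"
  by (induction n) simp_all

lemma eval_disc_power:
  fixes z :: "'a::{real_normed_field,banach}"
  assumes "abs_summable_fps f" "norm z \<le> 1"
  shows "eval_disc (f ^ n) z = eval_disc f z ^ n"
  by (induction n) (simp_all add: eval_disc_mult assms)

section \<open>Series with nonnegative summable coefficients\<close>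

definition nonneg_summable_fps :: "real fps \<Rightarrow> bool" where
  "nonneg_summable_fps f \<longleftrightarrow> (\<forall>n. 0 \<le> fps_nth f n) \<and> abs_summable_fps f"

lemma nonneg_summable_fps_mult:
  "nonneg_summable_fps f \<Longrightarrow> nonneg_summable_fps g \<Longrightarrow> nonneg_summable_fps (f * g)"
  by (auto simp: nonneg_summable_fps_def fps_mult_nth intro!: sum_nonneg)

lemma nonneg_summable_fps_add:
  "nonneg_summable_fps f \<Longrightarrow> nonneg_summable_fps g \<Longrightarrow> nonneg_summable_fps (f + g)"
  using abs_summable_fps_diff[of f "- g"]
  unfolding nonneg_summable_fps_def by (simp add: abs_summable_fps_def del: abs_of_nonneg)

lemma nonneg_summable_fps_monom:
  "0 \<le> c \<Longrightarrow> nonneg_summable_fps (fps_const c * fps_X ^ n)"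
  by (simp add: nonneg_summable_fps_def)

lemma nonneg_summable_fps_1: "nonneg_summable_fps 1"
  by (simp add: nonneg_summable_fps_def)

lemma nonneg_summable_fps_power: "nonneg_summable_fps f \<Longrightarrow> nonneg_summable_fps (f ^ n)"
  by (induction n) (simp_all add: nonneg_summable_fps_1 nonneg_summable_fps_mult)

text \<open>The index pairs with \<open>i + j < N\<close> lie in the square
  \<open>{..<N} \<times> {..<N}\<close>, so nonnegativity bounds the partial sum of the product by a
  product of partial sums.\<close>

lemma sum_mult_nth_le:
  fixes g h :: "real fps"
  assumes "nonneg_summable_fps g" "\<And>n. 0 \<le> fps_nth h n"
  shows "(\<Sum>n<N. fps_nth (h * g) n) \<le> (\<Sum>n<N. fps_nth h n) * eval_disc g 1"
proof -
  have g: "summable (fps_nth g)" "\<And>n. 0 \<le> fps_nth g n"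
    using assms(1) summable_rabs_cancel by (auto simp: nonneg_summable_fps_def abs_summable_fps_def)
  have "(\<Sum>n<N. fps_nth (h * g) n) = (\<Sum>(i,j)\<in>{(i,j). i + j < N}. fps_nth h i * fps_nth g j)"
    by (simp add: fps_mult_nth atLeast0AtMost sum.triangle_reindex)
  also have "\<dots> \<le> (\<Sum>(i,j)\<in>{..<N} \<times> {..<N}. fps_nth h i * fps_nth g j)"
    using assms(2) g(2) by (intro sum_mono2) auto
  also have "\<dots> = (\<Sum>i<N. fps_nth h i) * (\<Sum>j<N. fps_nth g j)"
    by (simp add: sum_product sum.cartesian_product)
  also have "\<dots> \<le> (\<Sum>i<N. fps_nth h i) * eval_disc g 1"
    unfolding eval_disc_def using assms(2) g
    by (intro mult_left_mono sum_nonneg) (simp_all add: sum_le_suminf)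
  finally show ?thesis .
qed

text \<open>
  Since \<open>h = 1 + c X h g\<close>, the partial sums \<open>S\<close> of \<open>h\<close> satisfy \<open>S \<le> 1 + c g(1) S\<close>.
\<close>
lemma nonneg_summable_fps_geometric:
  assumes g: "nonneg_summable_fps g" and c: "0 \<le> c" "c * eval_disc g 1 < 1"
    and h: "h * (1 - fps_const c * fps_X * g) = 1"
  shows "nonneg_summable_fps h"
proof -
  have g0: "\<And>n. 0 \<le> fps_nth g n" using g by (simp add: nonneg_summable_fps_def)
  have eq: "h = 1 + fps_const c * (fps_X * (h * g))" using h by (simp add: algebra_simps)
  have h0: "fps_nth h 0 = 1" by (subst eq) simp
  have hS: "fps_nth h (Suc n) = c * fps_nth (h * g) n" for n by (subst eq) simp
  have pos: "0 \<le> fps_nth h n" for n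
  proof (induction n rule: less_induct)
    case (less n)
    then show ?case
      by (cases n) (auto simp: h0 hS fps_mult_nth intro!: c g0 mult_nonneg_nonneg sum_nonneg)
  qed
  have "(\<Sum>n<N. fps_nth h n) \<le> 1 / (1 - c * eval_disc g 1)" for N
  proof -
    have "(\<Sum>n<N. fps_nth h n) \<le> (\<Sum>n<Suc N. fps_nth h n)" by (simp add: pos)
    also have "\<dots> = 1 + c * (\<Sum>n<N. fps_nth (h * g) n)"
      by (simp add: sum.lessThan_Suc_shift h0 hS sum_distrib_left del: sum.lessThan_Suc)
    also have "\<dots> \<le> 1 + c * ((\<Sum>n<N. fps_nth h n) * eval_disc g 1)"
      using c sum_mult_nth_le[OF g pos] by (intro add_left_mono mult_left_mono)
    finally show ?thesis using c by (simp add: field_simps)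
  qed
  then have "summable (fps_nth h)" by (intro summableI_nonneg_bounded pos)
  then show ?thesis using pos by (simp add: nonneg_summable_fps_def abs_summable_fps_def)
qed

text \<open>Dividing the relation by \<open>B\<close> gives
  \<open>B/A = 1 / (1 - c X (C/B))\<close>. At 1 it reads
  \<open>A(1) = B(1) (1 - c (C/B)(1))\<close>, so positivity of \<open>A(1)\<close> and
  \<open>B(1)\<close> is exactly the smallness that the geometric series needs.\<close>

lemma nonneg_summable_fps_ratio_step:
  fixes A B C :: "real fps"
  assumes rec: "A = B - fps_const c * fps_X * C" and c: "0 \<le> c"
    and nz: "fps_nth A 0 \<noteq> 0" "fps_nth B 0 \<noteq> 0"
    and summable: "abs_summable_fps B" "abs_summable_fps C"
    and pos: "0 < eval_disc A (1::real)" "0 < eval_disc B (1::real)"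
    and nn: "nonneg_summable_fps (C * inverse B)"
  shows "nonneg_summable_fps (B * inverse A)"
proof (rule nonneg_summable_fps_geometric[OF nn c])
  have B: "inverse B * B = 1" and A: "inverse A * A = 1" using nz by (simp_all add: inverse_mult_eq_1)
  have "eval_disc (C * inverse B) 1 * eval_disc B (1::real) = eval_disc C 1"
    using nn summable by (subst eval_disc_mult[symmetric])
      (simp_all add: nonneg_summable_fps_def mult.assoc B)
  moreover have "eval_disc A (1::real) = eval_disc B 1 - c * eval_disc C 1"
    unfolding rec by (simp add: eval_disc_diff eval_disc_mult summable)
  ultimately have "c * eval_disc (C * inverse B) 1 * eval_disc B (1::real) < 1 * eval_disc B 1"
    using pos by (simp add: mult.assoc)
  then show "c * eval_disc (C * inverse B) (1::real) < 1"
    using pos by (simp only: mult_less_cancel_right_pos)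
  have "B * inverse A * (1 - fps_const c * fps_X * (C * inverse B))
      = inverse A * (B - fps_const c * fps_X * C * (inverse B * B))" by (simp add: algebra_simps)
  also have "\<dots> = 1" using A rec B by simp
  finally show "B * inverse A * (1 - fps_const c * fps_X * (C * inverse B)) = 1" .
qed

section \<open>Order, degree and quotients of power series\<close>

lemma fps_X_power_dvd_iff:
  fixes f :: "'a::comm_ring_1 fps"
  shows "fps_X ^ n dvd f \<longleftrightarrow> (\<forall>i<n. fps_nth f i = 0)"
proof
  assume "fps_X ^ n dvd f"
  then show "\<forall>i<n. fps_nth f i = 0" by (auto elim!: dvdE simp: fps_X_power_mult_nth)
next
  assume "\<forall>i<n. fps_nth f i = 0"
  then have "f = fps_X ^ n * fps_shift n f" by (intro fps_ext) (simp add: fps_X_power_mult_nth)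
  then show "fps_X ^ n dvd f" by (metis dvd_triv_left)
qed

lemma fps_X_power_dvd_deriv:
  fixes f :: "'a::comm_ring_1 fps"
  shows "fps_X ^ Suc n dvd f \<Longrightarrow> fps_X ^ n dvd fps_deriv f"
  by (simp add: fps_X_power_dvd_iff del: power_Suc)

lemma fps_mult_nth_eq_0:
  fixes f g :: "'a::comm_ring_1 fps"
  assumes "\<And>i. k < i \<Longrightarrow> fps_nth f i = 0" "\<And>i. m < i \<Longrightarrow> fps_nth g i = 0" "k + m < n"
  shows "fps_nth (f * g) n = 0"
  unfolding fps_mult_nth
proof (rule sum.neutral, rule)
  fix i assume "i \<in> {0..n}"
  then have "k < i \<or> m < n - i" using assms(3) by auto
  then show "fps_nth f i * fps_nth g (n - i) = 0" using assms(1,2) by auto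
qed

lemma fps_quotient_eq_add:
  fixes A B C D :: "real fps"
  assumes "A * D - C * B = N" "fps_nth B 0 \<noteq> 0" "fps_nth D 0 \<noteq> 0"
  shows "A * inverse B = C * inverse D + N * (inverse D * inverse B)"
proof -
  have "inverse B * B = 1" "inverse D * D = 1" using assms by (simp_all add: inverse_mult_eq_1)
  then show ?thesis unfolding assms(1)[symmetric] by algebra
qed

section \<open>Contiguous relations\<close>

text \<open>
  \<open>pade_fps (1/p) k m\<close> is the denominator \<open>Q\<close>, and \<open>pade_fps (-1/p) m k\<close> is the numerator \<open>P\<close>. No
  truncation is needed: \<open>pochhammer (- real m) j\<close> vanishes for \<open>j > m\<close>, also where the quotient is
  \<open>0 / 0\<close>.
\<close>
definition pade_fps :: "real \<Rightarrow> nat \<Rightarrow> nat \<Rightarrow> real fps" where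
  "pade_fps a k m = Abs_fps (\<lambda>j. pochhammer (- real m) j * pochhammer (- a - real k) j
               / (fact j * pochhammer (- real k - real m) j))"

lemma pochhammer_neg_nonzero: "j \<le> n \<Longrightarrow> pochhammer (- real n) j \<noteq> 0"
  by (auto simp: pochhammer_eq_0_iff)

lemma pade_fps_nth_eq_0: "m < j \<Longrightarrow> fps_nth (pade_fps a k m) j = 0"
  by (simp add: pade_fps_def pochhammer_of_nat_eq_0_iff)

lemma pade_fps_nth_0 [simp]: "fps_nth (pade_fps a k m) 0 = 1"
  by (simp add: pade_fps_def)

text \<open>With \<open>n = k + m\<close>, splitting off the first or the last factor of
  \<open>pochhammer (-n-1) (Suc j)\<close> relates the parameters \<open>-n-1\<close> and
  \<open>-n\<close>. The bound on \<open>j\<close> keeps the divisor nonzero.\<close>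

lemma pochhammer_shift:
  assumes "j \<le> k + m"
  shows "pochhammer (- real k - real m - 2) (Suc j)
     = (real k + real m + 2) * (real k + real m + 1) * pochhammer (- real k - real m) j 
        / (real j - real k - real m - 1)"
proof -
  have "pochhammer (- real k - real m - 1) j * (- real k - real m - 1 + real j)
      = (- real k - real m - 1) * pochhammer (- real k - real m) j"
    using pochhammer_rec[of "- real k - real m - 1" j] pochhammer_rec'[of "- real k - real m - 1" j]
    by (simp add: mult.commute)
  moreover have "real j - real k - real m - 1 \<noteq> 0" using assms by linarith
  moreover have "pochhammer (- real k - real m - 2) (Suc j)
       = (- real k - real m - 2) * pochhammer (- real k - real m - 1) j"
    by (simp add: pochhammer_rec)
  ultimately show ?thesis
    by (simp add: eq_divide_eq) algebra
qed

text \<open>Each coefficient of index \<open>j + 1\<close> is a rational multiple of the coefficient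
  \<open>u v / (F w)\<close> of \<open>pade_fps a k m\<close> at \<open>j\<close>. Comparing
  coefficients thus leaves rational identities in \<open>a\<close>, \<open>K\<close>,
  \<open>M\<close>, \<open>J\<close>.\<close>

lemma pade_fps_rec:
  defines "d k m \<equiv> (real k + real m + 1) * (real k + real m + 2)"
  shows pade_fps_rec_num: "pade_fps a (Suc k) (Suc m) = pade_fps a k (Suc m)
          - fps_const ((real m + 1) * (real m + 1 - a) / d k m) * fps_X * pade_fps a k m"
    and pade_fps_rec_den: "pade_fps a (Suc k) (Suc m) = pade_fps a (Suc k) m
          - fps_const ((real k + 1) * (real k + 1 + a) / d k m) * fps_X * pade_fps a k m"
proof -
  have core: "fps_nth (pade_fps a (Suc k) (Suc m)) (Suc j) = fps_nth (pade_fps a k (Suc m)) (Suc j)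
        - (real m + 1) * (real m + 1 - a) / d k m * fps_nth (pade_fps a k m) j \<and>
       fps_nth (pade_fps a (Suc k) (Suc m)) (Suc j) = fps_nth (pade_fps a (Suc k) m) (Suc j)
        - (real k + 1) * (real k + 1 + a) / d k m * fps_nth (pade_fps a k m) j" for j
  proof (cases "j \<le> m")
    \<comment> \<open>Beyond degree \<open>m\<close> both relations read
      \<open>0 = 0\<close>.\<close>
    case False
    then show ?thesis by (simp add: pade_fps_nth_eq_0)
  next
    case True
    define u where "u = pochhammer (- real m) j"
    define v where "v = pochhammer (- a - real k) j"
    define w where "w = pochhammer (- real k - real m) j"
    define F :: real where "F = fact j"
    define K where "K = real k" define M where "M = real m" define J where "J = real j"
    have nz: "w \<noteq> 0" "F \<noteq> 0" "J - K - M - 1 \<noteq> 0" "J + 1 \<noteq> 0" "K + M + 1 \<noteq> 0" "K + M + 2 \<noteq> 0"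
      using True pochhammer_neg_nonzero[of j "k + m"]
      by (auto simp: w_def F_def J_def K_def M_def algebra_simps)
    have neg: "- K - M - 1 \<noteq> 0" using nz by linarith
    have e0: "fps_nth (pade_fps a k m) j = u * v / (F * w)"
      by (simp add: pade_fps_def u_def v_def w_def F_def)
    have e1: "fps_nth (pade_fps a (Suc k) (Suc m)) (Suc j)
        = (- M - 1) * u * ((- a - K - 1) * v) / ((J + 1) * F * ((K + M + 2) * (K + M + 1) * w / (J - K - M - 1)))"
    proof -
      have "pochhammer (- real (Suc m)) (Suc j) = (- M - 1) * u"
        by (simp add: pochhammer_rec u_def M_def)
      moreover have "pochhammer (- a - real (Suc k)) (Suc j) = (- a - K - 1) * v"
        by (simp add: pochhammer_rec v_def K_def algebra_simps)
      moreover have "pochhammer (- real (Suc k) - real (Suc m)) (Suc j)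
          = (K + M + 2) * (K + M + 1) * w / (J - K - M - 1)"
        using pochhammer_shift[of j k m] True
        by (simp add: w_def K_def M_def J_def algebra_simps)
      ultimately show ?thesis
        by (simp add: pade_fps_def F_def J_def add.commute)
    qed
    have den: "pochhammer (- K - M - 1) (Suc j) = (- K - M - 1) * w"
      by (simp add: pochhammer_rec w_def K_def M_def)
    have e2: "fps_nth (pade_fps a k (Suc m)) (Suc j)
        = (- M - 1) * u * (v * (J - a - K)) / ((J + 1) * F * ((- K - M - 1) * w))"
    proof -
      have "pochhammer (- real (Suc m)) (Suc j) = (- M - 1) * u"
        by (simp add: pochhammer_rec u_def M_def)
      moreover have "pochhammer (- a - real k) (Suc j) = v * (J - a - K)"
        by (simp add: pochhammer_rec' v_def K_def J_def algebra_simps)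
      moreover have "pochhammer (- real k - real (Suc m)) (Suc j) = (- K - M - 1) * w"
      proof -
        have "- real k - real (Suc m) = - K - M - 1" by (simp add: K_def M_def)
        then show ?thesis by (simp only: den)
      qed
      ultimately show ?thesis
        by (simp only: pade_fps_def fps_nth_Abs_fps) (simp add: F_def J_def add.commute)
    qed
    have e3: "fps_nth (pade_fps a (Suc k) m) (Suc j)
        = (J - M) * u * ((- a - K - 1) * v) / ((J + 1) * F * ((- K - M - 1) * w))"
    proof -
      have "pochhammer (- real m) (Suc j) = (J - M) * u"
        by (simp add: pochhammer_rec' u_def M_def J_def algebra_simps)
      moreover have "pochhammer (- a - real (Suc k)) (Suc j) = (- a - K - 1) * v"
        by (simp add: pochhammer_rec v_def K_def algebra_simps)
      moreover have "pochhammer (- real (Suc k) - real m) (Suc j) = (- K - M - 1) * w"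
      proof -
        have "- real (Suc k) - real m = - K - M - 1" by (simp add: K_def M_def)
        then show ?thesis by (simp only: den)
      qed
      ultimately show ?thesis
        by (simp only: pade_fps_def fps_nth_Abs_fps) (simp add: F_def J_def add.commute)
    qed
    have "(- M - 1) * u * ((- a - K - 1) * v) / ((J + 1) * F * ((K + M + 2) * (K + M + 1) * w / (J - K - M - 1)))
        = (- M - 1) * u * (v * (J - a - K)) / ((J + 1) * F * ((- K - M - 1) * w))
          - (M + 1) * (M + 1 - a) / ((K + M + 1) * (K + M + 2)) * (u * v / (F * w))"
      using nz neg by (simp add: divide_simps) algebra
    moreover have "(- M - 1) * u * ((- a - K - 1) * v) / ((J + 1) * F * ((K + M + 2) * (K + M + 1) * w / (J - K - M - 1)))
        = (J - M) * u * ((- a - K - 1) * v) / ((J + 1) * F * ((- K - M - 1) * w))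
          - (K + 1) * (K + 1 + a) / ((K + M + 1) * (K + M + 2)) * (u * v / (F * w))"
      using nz neg by (simp add: divide_simps) algebra
    ultimately show ?thesis
      unfolding e0 e1 e2 e3 d_def K_def M_def by blast
  qed
  show "pade_fps a (Suc k) (Suc m) = pade_fps a k (Suc m)
          - fps_const ((real m + 1) * (real m + 1 - a) / d k m) * fps_X * pade_fps a k m"
  proof (rule fps_ext)
    fix n show "fps_nth (pade_fps a (Suc k) (Suc m)) n = fps_nth (pade_fps a k (Suc m)
          - fps_const ((real m + 1) * (real m + 1 - a) / d k m) * fps_X * pade_fps a k m) n"
      using core[of "n - 1"] by (cases n) (auto simp: mult.assoc)
  qed
  show "pade_fps a (Suc k) (Suc m) = pade_fps a (Suc k) m
          - fps_const ((real k + 1) * (real k + 1 + a) / d k m) * fps_X * pade_fps a k m"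
  proof (rule fps_ext)
    fix n show "fps_nth (pade_fps a (Suc k) (Suc m)) n = fps_nth (pade_fps a (Suc k) m
          - fps_const ((real k + 1) * (real k + 1 + a) / d k m) * fps_X * pade_fps a k m) n"
      using core[of "n - 1"] by (cases n) (auto simp: mult.assoc)
  qed
qed

text \<open>The sum is the terminating hypergeometric value 2F1(-m, -a-k; -k-m; 1), which
  Chu-Vandermonde evaluates in closed form.\<close>

lemma pade_fps_sum_pos:
  assumes "0 < a" "a < 1"
  shows "0 < (\<Sum>j\<le>m. fps_nth (pade_fps a k m) j)"
proof -
  have c: "- real k - real m \<noteq> - real i" if "i < m" for i using that by simp
  have "(\<Sum>j\<le>m. fps_nth (pade_fps a k m) j) = pochhammer (a - real m) m / pochhammer (- real k - real m) m"
    using Vandermonde_pochhammer[of m "- real k - real m" "- a - real k"] c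
    by (simp add: pade_fps_def atLeast0AtMost algebra_simps)
  \<comment> \<open>Reversing the order of the factors gives a sign \<open>(-1) ^ m\<close> above
    and below; the two cancel.\<close>
  also have "\<dots> = pochhammer (1 - a) m / pochhammer (real k + 1) m"
    using pochhammer_minus[of "real m - a" m] pochhammer_minus[of "real k + real m" m]
    by (simp add: algebra_simps)
  also have "\<dots> > 0"
    using assms by (intro divide_pos_pos pochhammer_pos) auto
  finally show ?thesis .
qed

lemma pade_fps_0 [simp]: "pade_fps a k 0 = 1"
proof (rule fps_ext)
  fix n show "fps_nth (pade_fps a k 0) n = fps_nth 1 n"
    by (cases n) (simp_all add: pade_fps_nth_eq_0)
qed

lemma pade_fps_0_1: "pade_fps a 0 (Suc 0) = 1 - fps_const a * fps_X"
proof (rule fps_ext)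
  fix n :: nat
  consider "n = 0" | "n = 1" | "1 < n" by linarith
  then show "fps_nth (pade_fps a 0 (Suc 0)) n = fps_nth (1 - fps_const a * fps_X) n"
    by cases (simp_all add: pade_fps_nth_eq_0, simp_all add: pade_fps_def)
qed

text \<open>For \<open>m = 0\<close> the factors \<open>pochhammer (- real k) j\<close> cancel, and
  the numerator is the Taylor polynomial of degree \<open>k\<close> of (1-z)^(-a). The inductions
  over \<open>m\<close> below start here.\<close>

lemma pade_fps_0_left_nth:
  "fps_nth (pade_fps (- a) 0 k) j = (if j \<le> k then pochhammer a j / fact j else 0)"
  using pochhammer_neg_nonzero[of j k] by (simp add: pade_fps_nth_eq_0) (simp add: pade_fps_def)

lemma abs_summable_pade_fps [simp]: "abs_summable_fps (pade_fps a k m)"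
  by (rule abs_summable_fps_poly) (rule pade_fps_nth_eq_0)

section \<open>Nonnegativity and order of approximation\<close>

context
  fixes a :: real
  assumes a: "0 < a" "a < 1"
begin

abbreviation Q :: "nat \<Rightarrow> nat \<Rightarrow> real fps" where "Q k m \<equiv> pade_fps a k m"
abbreviation P :: "nat \<Rightarrow> nat \<Rightarrow> real fps" where "P k m \<equiv> pade_fps (- a) m k"
abbreviation R :: "nat \<Rightarrow> nat \<Rightarrow> real fps" where "R k m \<equiv> P k m * inverse (Q k m)"

lemma inverse_Q_mult: "inverse (Q k m) * Q k m = 1"
  by (simp add: inverse_mult_eq_1)

lemma eval_disc_Q_pos: "0 < eval_disc (Q k m) (1::real)"
  using pade_fps_sum_pos[OF a, of k m]
  by (subst eval_disc_eq_sum[of m]) (simp_all add: pade_fps_nth_eq_0)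

text \<open>Exchanging \<open>k\<close> with \<open>m\<close> and \<open>a\<close> with
  \<open>-a\<close> turns one contiguous relation into the other, constant included; hence
  \<open>P\<close> and \<open>Q\<close> share the same \<open>c\<close>.\<close>

lemma pade_rec_num:
  obtains c where "0 \<le> c"
    "Q (Suc k) (Suc m) = Q k (Suc m) - fps_const c * fps_X * Q k m"
    "P (Suc k) (Suc m) = P k (Suc m) - fps_const c * fps_X * P k m"
proof
  let ?c = "(real m + 1) * (real m + 1 - a) / ((real k + real m + 1) * (real k + real m + 2))"
  show "0 \<le> ?c" using a by simp
  show "Q (Suc k) (Suc m) = Q k (Suc m) - fps_const ?c * fps_X * Q k m" by (rule pade_fps_rec_num)
  show "P (Suc k) (Suc m) = P k (Suc m) - fps_const ?c * fps_X * P k m"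
    using pade_fps_rec_den[of "- a" m k] by (simp add: add.commute)
qed

lemma pade_rec_den:
  obtains c where "0 \<le> c"
    "Q (Suc k) (Suc m) = Q (Suc k) m - fps_const c * fps_X * Q k m"
    "P (Suc k) (Suc m) = P (Suc k) m - fps_const c * fps_X * P k m"
proof
  let ?c = "(real k + 1) * (real k + 1 + a) / ((real k + real m + 1) * (real k + real m + 2))"
  show "0 \<le> ?c" using a by simp
  show "Q (Suc k) (Suc m) = Q (Suc k) m - fps_const ?c * fps_X * Q k m" by (rule pade_fps_rec_den)
  show "P (Suc k) (Suc m) = P (Suc k) m - fps_const ?c * fps_X * P k m"
    using pade_fps_rec_num[of "- a" m k] by (simp add: add.commute)
qed

text \<open>The first assumption is the statement of \<open>nonneg_ratio_num\<close> at
  \<open>m\<close>. Passing it as a hypothesis lets the ratios in both directions be handled by one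
  induction on \<open>m\<close>.\<close>

lemma nonneg_ratio_den:
  assumes "\<And>k. m \<le> Suc k \<Longrightarrow> nonneg_summable_fps (Q k m * inverse (Q (Suc k) m))" "m \<le> k"
  shows "nonneg_summable_fps (Q k m * inverse (Q k (Suc m)))"
proof (cases k)
  \<comment> \<open>The relation used below needs a smaller index \<open>l\<close>, so
    \<open>k = 0\<close> is done directly: \<open>Q 0 1 = 1 - a X\<close>, whose inverse is a
    geometric series.\<close>
  case 0
  then have "m = 0" using assms by simp
  have "nonneg_summable_fps (1 * inverse (Q 0 (Suc 0)))"
    by (rule nonneg_summable_fps_ratio_step[of _ _ a 1])
      (use a eval_disc_Q_pos[of 0 "Suc 0"] in \<open>simp_all add: pade_fps_0_1 nonneg_summable_fps_1\<close>)
  then show ?thesis using 0 \<open>m = 0\<close> by simp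
next
  case (Suc l)
  obtain c where c: "0 \<le> c" "Q (Suc l) (Suc m) = Q (Suc l) m - fps_const c * fps_X * Q l m"
    by (rule pade_rec_den)
  show ?thesis unfolding Suc
    by (rule nonneg_summable_fps_ratio_step[OF c(2,1)]) 
      (use assms Suc in \<open>simp_all add: eval_disc_Q_pos\<close>)
qed

text \<open>In the step from \<open>m\<close> to \<open>m + 1\<close> the ratio \<open>C/B\<close>
  is \<open>Q k m / Q k (m+1)\<close>, supplied by \<open>nonneg_ratio_den\<close>; its condition
  \<open>m \<le> k\<close> is \<open>Suc m \<le> Suc k\<close>.\<close>

lemma nonneg_ratio_num:
  "m \<le> Suc k \<Longrightarrow> nonneg_summable_fps (Q k m * inverse (Q (Suc k) m))"
proof (induction m arbitrary: k)
  case 0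
  then show ?case by (simp add: nonneg_summable_fps_1)
next
  case (Suc m)
  obtain c where c: "0 \<le> c" "Q (Suc k) (Suc m) = Q k (Suc m) - fps_const c * fps_X * Q k m"
    by (rule pade_rec_num)
  show ?case
    by (rule nonneg_summable_fps_ratio_step[OF c(2,1)])
      (use Suc in \<open>simp_all add: eval_disc_Q_pos nonneg_ratio_den\<close>)
qed

text \<open>Telescoping: \<open>1 / Q k m\<close> is the product of the ratios
  \<open>Q k i / Q k (i+1)\<close> over \<open>i < m\<close>.\<close>

lemma nonneg_inverse_Q: "m \<le> Suc k \<Longrightarrow> nonneg_summable_fps (inverse (Q k m))"
proof (induction m)
  case 0
  then show ?case by (simp add: nonneg_summable_fps_1)
next
  case (Suc m)
  have "inverse (Q k (Suc m)) = inverse (Q k m) * (Q k m * inverse (Q k (Suc m)))"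
    by (simp add: inverse_Q_mult flip: mult.assoc)
  then show ?case
    using Suc nonneg_summable_fps_mult[OF _ nonneg_ratio_den[OF nonneg_ratio_num, of m k]]
    by (metis Suc_leD Suc_le_mono le_SucI)
qed

text \<open>Inserting the contiguous relations cancels the leading products and leaves
  \<open>b X\<close> times the determinant in the other direction. As for the ratios, that
  determinant enters as a hypothesis at \<open>m\<close>.\<close>

lemma det_den:
  assumes "\<And>k. m \<le> Suc k \<Longrightarrow>
      \<exists>c\<ge>0. P (Suc k) m * Q k m - P k m * Q (Suc k) m = fps_const c * fps_X ^ Suc (k + m)"
    and "m \<le> k"
  shows "\<exists>c\<ge>0. P k (Suc m) * Q k m - P k m * Q k (Suc m) = fps_const c * fps_X ^ Suc (k + m)"
proof (cases k)
  case 0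
  then have "m = 0" using assms by simp
  then show ?thesis using 0 a by (intro exI[of _ a]) (simp add: pade_fps_0_1)
next
  case (Suc l)
  obtain b where b: "0 \<le> b" "Q (Suc l) (Suc m) = Q (Suc l) m - fps_const b * fps_X * Q l m"
    "P (Suc l) (Suc m) = P (Suc l) m - fps_const b * fps_X * P l m"
    by (rule pade_rec_den)
  obtain c where c: "0 \<le> c" 
    "P (Suc l) m * Q l m - P l m * Q (Suc l) m = fps_const c * fps_X ^ Suc (l + m)"
    using assms Suc by (metis)
  have "P (Suc l) (Suc m) * Q (Suc l) m - P (Suc l) m * Q (Suc l) (Suc m)
      = fps_const b * fps_X * (P (Suc l) m * Q l m - P l m * Q (Suc l) m)"
    unfolding b by (simp add: algebra_simps)
  also have "\<dots> = fps_const (b * c) * fps_X ^ Suc (Suc l + m)"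
    unfolding c fps_const_mult[symmetric] by (simp add: mult_ac)
  finally show ?thesis using b c Suc by (intro exI[of _ "b * c"]) simp
qed

lemma det_num:
  "m \<le> Suc k \<Longrightarrow>
    \<exists>c\<ge>0. P (Suc k) m * Q k m - P k m * Q (Suc k) m = fps_const c * fps_X ^ Suc (k + m)"
proof (induction m arbitrary: k)
  case 0
  \<comment> \<open>Consecutive Taylor polynomials differ by the term of degree
    \<open>k + 1\<close>.\<close>
  have "P (Suc k) 0 - P k 0 = fps_const (pochhammer a (Suc k) / fact (Suc k)) * fps_X ^ Suc k"
    by (rule fps_ext)
      (auto simp: pade_fps_0_left_nth fps_X_power_nth le_Suc_eq simp del: power_Suc fact_Suc)
  moreover have "0 \<le> pochhammer a (Suc k) / fact (Suc k)"
    using a by (intro divide_nonneg_nonneg pochhammer_nonneg) auto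
  ultimately show ?case by auto
next
  case (Suc m)
  obtain b where b: "0 \<le> b" "Q (Suc k) (Suc m) = Q k (Suc m) - fps_const b * fps_X * Q k m"
    "P (Suc k) (Suc m) = P k (Suc m) - fps_const b * fps_X * P k m"
    by (rule pade_rec_num)
  obtain c where c: "0 \<le> c"
    "P k (Suc m) * Q k m - P k m * Q k (Suc m) = fps_const c * fps_X ^ Suc (k + m)"
    using det_den[OF Suc.IH, of k] Suc.prems by auto
  have "P (Suc k) (Suc m) * Q k (Suc m) - P k (Suc m) * Q (Suc k) (Suc m)
      = fps_const b * fps_X * (P k (Suc m) * Q k m - P k m * Q k (Suc m))"
    unfolding b by (simp add: algebra_simps)
  also have "\<dots> = fps_const (b * c) * fps_X ^ Suc (k + Suc m)"
    unfolding c fps_const_mult[symmetric] by (simp add: mult_ac)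
  finally show ?case using b c by (intro exI[of _ "b * c"]) simp
qed

lemma R_den_step:
  assumes "m \<le> k"
  obtains c where "0 \<le> c" "R k (Suc m) = R k m
      + fps_const c * fps_X ^ Suc (k + m) * (inverse (Q k m) * inverse (Q k (Suc m)))"
  using det_den[OF det_num assms] fps_quotient_eq_add[of "P k (Suc m)" "Q k m" "P k m" "Q k (Suc m)"]
  by (metis pade_fps_nth_0 zero_neq_one)

lemma R_num_step:
  assumes "m \<le> Suc k"
  obtains c where "0 \<le> c" "R (Suc k) m = R k m
      + fps_const c * fps_X ^ Suc (k + m) * (inverse (Q k m) * inverse (Q (Suc k) m))"
  using det_num[OF assms] fps_quotient_eq_add[of "P (Suc k) m" "Q k m" "P k m" "Q (Suc k) m"]
  by (metis pade_fps_nth_0 zero_neq_one)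

text \<open>Starting from the Taylor polynomial \<open>R k 0\<close>, each increase of
  \<open>m\<close> adds a nonnegative monomial times two inverse denominators.\<close>

lemma nonneg_R: "m \<le> Suc k \<Longrightarrow> nonneg_summable_fps (R k m)"
proof (induction m)
  case 0
  then show ?case
    using a by (auto simp: nonneg_summable_fps_def pade_fps_0_left_nth pochhammer_nonneg)
next
  case (Suc m)
  then have "m \<le> k" by simp
  then obtain c where c: "0 \<le> c" "R k (Suc m) = R k m
      + fps_const c * fps_X ^ Suc (k + m) * (inverse (Q k m) * inverse (Q k (Suc m)))"
    by (rule R_den_step)
  have "nonneg_summable_fps
      (fps_const c * fps_X ^ Suc (k + m) * (inverse (Q k m) * inverse (Q k (Suc m))))"
    using Suc.prems c(1)
    by (intro nonneg_summable_fps_mult[OF nonneg_summable_fps_monom]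
        nonneg_summable_fps_mult[OF nonneg_inverse_Q nonneg_inverse_Q]) auto
  then show ?case unfolding c(2) using Suc by (intro nonneg_summable_fps_add) auto
qed

text \<open>
  Moving along a column and along a row by one step each links \<open>R k (m+1)\<close> to \<open>R (k+1) m\<close> modulo
  \<open>X ^ (k+m+2)\<close>, so the order of approximation propagates from the Taylor polynomials \<open>R k 0\<close>.
\<close>
lemma R_approximates:
  "m \<le> Suc k \<Longrightarrow> fps_X ^ Suc (k + m) dvd Abs_fps (\<lambda>j. pochhammer a j / fact j) - R k m"
proof (induction m arbitrary: k)
  case 0
  show ?case by (simp add: fps_X_power_dvd_iff pade_fps_0_left_nth del: power_Suc)
next
  case (Suc m)
  let ?f = "Abs_fps (\<lambda>j. pochhammer a j / fact j)" and ?X = "fps_X ^ Suc (k + Suc m) :: real fps"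
  have "?X dvd ?f - R (Suc k) m" using Suc.IH[of "Suc k"] Suc.prems by simp
  moreover have "?X dvd R (Suc k) (Suc m) - R (Suc k) m"
  proof -
    obtain c where "R (Suc k) (Suc m) = R (Suc k) m
        + fps_const c * fps_X ^ Suc (Suc k + m) * (inverse (Q (Suc k) m) * inverse (Q (Suc k) (Suc m)))"
      using R_den_step[of m "Suc k"] Suc.prems by auto
    then show ?thesis by (simp del: power_Suc)
  qed
  moreover have "?X dvd R (Suc k) (Suc m) - R k (Suc m)"
  proof -
    obtain c where "R (Suc k) (Suc m) = R k (Suc m)
        + fps_const c * ?X * (inverse (Q k (Suc m)) * inverse (Q (Suc k) (Suc m)))"
      using R_num_step[OF Suc.prems] by auto
    then show ?thesis by (simp del: power_Suc)
  qed
  ultimately have "?X dvd (?f - R (Suc k) m) - (R (Suc k) (Suc m) - R (Suc k) m)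
      + (R (Suc k) (Suc m) - R k (Suc m))"
    by (rule dvd_add[OF dvd_diff])
  then show ?case by (simp del: power_Suc)
qed

text \<open>The operator \<open>L\<close> annihilates the series of (1-z)^(-a), so
  \<open>L (R k m)\<close> inherits the order of approximation less one. Multiplied by
  \<open>Q k m ^ 2\<close> it becomes the polynomial \<open>W\<close> of degree at most
  \<open>k + m\<close>, and order and degree together leave a single monomial.\<close>

lemma R_diff_eq:
  assumes "m \<le> Suc k"
  obtains C where "fps_const a * R k m - (1 - fps_X) * fps_deriv (R k m)
      = fps_const C * fps_X ^ (k + m) * inverse (Q k m) ^ 2"
proof -
  let ?f = "Abs_fps (\<lambda>j. pochhammer a j / fact j)"
  define L where "L g = fps_const a * g - (1 - fps_X) * fps_deriv g" for g :: "real fps"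
  define W where "W = fps_const a * P k m * Q k m
      - (1 - fps_X) * (fps_deriv (P k m) * Q k m - P k m * fps_deriv (Q k m))"
  have "L ?f = 0"
  proof (rule fps_ext)
    fix n
    have "real (Suc n) * (pochhammer a (Suc n) / fact (Suc n)) = (a + n) * (pochhammer a n / fact n)"
      by (simp add: pochhammer_rec' divide_simps)
    then show "fps_nth (L ?f) n = fps_nth 0 n"
      by (cases n) (simp_all add: L_def left_diff_distrib distrib_right add_divide_distrib
          del: fact_Suc of_nat_Suc)
  qed
  then have "L (R k m) = - L (?f - R k m)" by (simp add: L_def algebra_simps)
  moreover have "fps_X ^ (k + m) dvd L g" if "fps_X ^ Suc (k + m) dvd g" for g
    unfolding L_def using that
    by (intro dvd_diff dvd_mult fps_X_power_dvd_deriv) (auto intro: dvd_trans[OF le_imp_power_dvd])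
  ultimately have "fps_X ^ (k + m) dvd L (R k m)"
    using R_approximates[OF assms] by simp
  moreover have P: "P k m = R k m * Q k m" by (simp add: mult.assoc inverse_Q_mult)
  have W: "W = L (R k m) * Q k m ^ 2"
  proof -
    have "fps_deriv (P k m) = fps_deriv (R k m) * Q k m + R k m * fps_deriv (Q k m)"
      by (subst P) (simp only: fps_deriv_mult add.commute mult.commute)
    then show ?thesis unfolding W_def L_def using P by algebra
  qed
  ultimately have ord: "fps_nth W n = 0" if "n < k + m" for n
    using that fps_X_power_dvd_iff dvd_mult2 by metis
  have deg: "fps_nth W n = 0" if "k + m < n" for n
  proof -
    \<comment> \<open>Grouping \<open>fps_X\<close> with the derivative keeps the bounds
      \<open>k\<close> and \<open>m\<close>; the factor \<open>1 - fps_X\<close> then does not push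
      the degree of \<open>W\<close> above \<open>k + m\<close>.\<close>
    have p: "fps_nth (P k m) i = 0" "fps_nth (fps_deriv (P k m)) i = 0"
      "fps_nth (fps_X * fps_deriv (P k m)) i = 0" if "k < i" for i
      using that by (auto simp: pade_fps_nth_eq_0)
    have q: "fps_nth (Q k m) i = 0" "fps_nth (fps_deriv (Q k m)) i = 0"
      "fps_nth (fps_X * fps_deriv (Q k m)) i = 0" if "m < i" for i
      using that by (auto simp: pade_fps_nth_eq_0)
    have "W = fps_const a * (P k m * Q k m) - fps_deriv (P k m) * Q k m + P k m * fps_deriv (Q k m)
        + (fps_X * fps_deriv (P k m)) * Q k m - P k m * (fps_X * fps_deriv (Q k m))"
      by (simp add: W_def algebra_simps)
    then show ?thesis
      using fps_mult_nth_eq_0[OF p(1) q(1) that] fps_mult_nth_eq_0[OF p(2) q(1) that]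
        fps_mult_nth_eq_0[OF p(1) q(2) that] fps_mult_nth_eq_0[OF p(3) q(1) that]
        fps_mult_nth_eq_0[OF p(1) q(3) that]
      by simp
  qed
  have "W = fps_const (fps_nth W (k + m)) * fps_X ^ (k + m)"
  proof (rule fps_ext)
    fix n show "fps_nth W n = fps_nth (fps_const (fps_nth W (k + m)) * fps_X ^ (k + m)) n"
      using ord[of n] deg[of n] by (cases "n < k + m"; cases "n = k + m") (auto simp: fps_X_power_nth)
  qed
  moreover have "L (R k m) = W * inverse (Q k m) ^ 2"
    unfolding W using inverse_Q_mult[of k m] by algebra
  ultimately show ?thesis using that unfolding L_def by metis
qed

section \<open>The residual\<close>

definition residual :: "nat \<Rightarrow> nat \<Rightarrow> nat \<Rightarrow> real fps" where
  "residual p k m = 1 - (1 - fps_X) * R k m ^ p"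

text \<open>Summability of \<open>inverse (Q k m)\<close> on the closed disc shows that the
  denominator has no zero there. The boundary is included because \<open>z = 1\<close> yields the
  sum of the coefficients.\<close>

lemma eval_disc_residual:
  fixes z :: "'a::{real_normed_field,banach}"
  assumes "m \<le> Suc k" "norm z \<le> 1"
  shows "eval_disc (residual p k m) z = 1 - (1 - z) * (eval_disc (P k m) z / eval_disc (Q k m) z) ^ p"
proof -
  have iQ: "abs_summable_fps (inverse (Q k m))"
    using nonneg_inverse_Q[OF assms(1)] by (simp add: nonneg_summable_fps_def)
  have "eval_disc (inverse (Q k m)) z * eval_disc (Q k m) z = 1"
    using assms iQ by (simp add: inverse_Q_mult flip: eval_disc_mult)
  then have "eval_disc (inverse (Q k m)) z = 1 / eval_disc (Q k m) z"
    by (metis divide_eq_eq mult_zero_right zero_neq_one)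
  then show ?thesis
    using assms iQ by (simp add: residual_def eval_disc_diff eval_disc_mult eval_disc_power)
qed

lemma residual_nonneg:
  assumes m: "m \<le> Suc k" and p: "real p * a = 1"
  shows "nonneg_summable_fps (residual p k m)" "n \<le> k + m \<Longrightarrow> fps_nth (residual p k m) n = 0"
proof -
  let ?F = "residual p k m"
  have p0: "0 < p" using p by (cases p) auto
  obtain C where C: "fps_const a * R k m - (1 - fps_X) * fps_deriv (R k m)
      = fps_const C * fps_X ^ (k + m) * inverse (Q k m) ^ 2"
    using R_diff_eq[OF m] .
  define G where "G = fps_X ^ (k + m) * (R k m ^ (p - 1) * inverse (Q k m) ^ 2)"
  have "nonneg_summable_fps (fps_const 1 * fps_X ^ (k + m) * (R k m ^ (p - 1) * inverse (Q k m) ^ 2))"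
    using nonneg_R[OF m] nonneg_inverse_Q[OF m]
    by (intro nonneg_summable_fps_mult[OF nonneg_summable_fps_monom]
        nonneg_summable_fps_mult[OF nonneg_summable_fps_power nonneg_summable_fps_power]) auto
  then have G: "0 \<le> fps_nth G n" for n by (simp add: G_def nonneg_summable_fps_def)
  have "fps_deriv ?F = R k m ^ p
      - (1 - fps_X) * (fps_const (real p) * fps_deriv (R k m) * R k m ^ (p - 1))"
    by (simp add: residual_def fps_deriv_power)
  \<comment> \<open>The factor \<open>p a = 1\<close> is inserted so that
    \<open>R k m ^ (p - 1)\<close> can be pulled out of both terms.\<close>
  also have "R k m ^ p = fps_const (real p) * fps_const a * R k m * R k m ^ (p - 1)"
    using p p0 by (simp add: power_eq_if)
  also have "fps_const (real p) * fps_const a * R k m * R k m ^ (p - 1)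
      - (1 - fps_X) * (fps_const (real p) * fps_deriv (R k m) * R k m ^ (p - 1))
      = fps_const (real p) * R k m ^ (p - 1)
        * (fps_const a * R k m - (1 - fps_X) * fps_deriv (R k m))"
    by algebra
  also have "\<dots> = fps_const (real p) * (fps_const C * G)"
    unfolding C G_def by (simp only: mult_ac)
  finally have "fps_nth (fps_deriv ?F) n = real p * (C * fps_nth G n)" for n by simp
  then have coeff: "real (Suc n) * fps_nth ?F (Suc n) = real p * (C * fps_nth G n)" for n by simp
  have F0: "fps_nth ?F 0 = 0" by (simp add: residual_def fps_nth_power_0)
  have summ: "abs_summable_fps ?F"
    using nonneg_R[OF m] by (simp add: residual_def nonneg_summable_fps_def)
  \<comment> \<open>No formula for \<open>C\<close> is needed: a negative \<open>C\<close> would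
    make all coefficients nonpositive, although they sum to the value 1 at
    \<open>z = 1\<close>.\<close>
  have "0 \<le> C"
  proof (rule ccontr)
    assume "\<not> 0 \<le> C"
    then have "real (Suc n) * fps_nth ?F (Suc n) \<le> 0" for n
      unfolding coeff using G by (intro mult_nonneg_nonpos mult_nonpos_nonneg) auto
    then have "fps_nth ?F n \<le> 0" for n
      using F0 by (cases n) (auto simp: mult_le_0_iff)
    moreover have "fps_nth ?F sums (1::real)"
      using eval_disc_sums[OF summ, of "1::real"] by (simp add: eval_disc_residual[OF m])
    ultimately have "(1::real) \<le> 0" using sums_le[OF _ _ sums_zero] by blast
    then show False by simp
  qed
  then have "0 \<le> real (Suc n) * fps_nth ?F (Suc n)" for n unfolding coeff using G by simp
  then have "0 \<le> fps_nth ?F n" for n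
    using F0 by (cases n) (auto simp: zero_le_mult_iff)
  then show "nonneg_summable_fps ?F" using summ by (simp add: nonneg_summable_fps_def)
  show "fps_nth ?F n = 0" if "n \<le> k + m"
  proof (cases n)
    case (Suc i)
    then have "fps_nth G i = 0" using that by (simp add: G_def fps_X_power_mult_nth)
    then show ?thesis using coeff[of i] Suc by simp
  qed (simp add: F0)
qed

text \<open>The coefficients are weights of total 1 on indices \<open>n \<ge> k + m + 1\<close>,
  where \<open>norm z ^ n \<le> norm z ^ (k + m + 1)\<close>.\<close>

lemma norm_residual_le:
  fixes z :: "'a::{real_normed_field,banach}"
  assumes m: "m \<le> Suc k" and p: "real p * a = 1" and z: "norm z \<le> 1"
  shows "norm (eval_disc (residual p k m) z) \<le> norm z ^ (k + m + 1)"
proof -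
  let ?F = "residual p k m" and ?N = "k + m + 1"
  note F = residual_nonneg[OF m p]
  have summ: "abs_summable_fps ?F" and pos: "\<And>n. 0 \<le> fps_nth ?F n"
    using F(1) by (simp_all add: nonneg_summable_fps_def)
  have one: "fps_nth ?F sums (1::real)"
    using eval_disc_sums[OF summ, of "1::real"] by (simp add: eval_disc_residual[OF m])
  have "norm (eval_disc ?F z) \<le> (\<Sum>n. norm (of_real (fps_nth ?F n) * z ^ n))"
    unfolding eval_disc_def by (intro summable_norm summable_norm_eval_disc summ z)
  also have "\<dots> \<le> (\<Sum>n. fps_nth ?F n * norm z ^ ?N)"
  proof (rule suminf_le)
    show "norm (of_real (fps_nth ?F n) * z ^ n) \<le> fps_nth ?F n * norm z ^ ?N" for n
    proof (cases "n \<le> k + m")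
      case True
      then show ?thesis using F(2) by simp
    next
      case False
      then show ?thesis using pos[of n] z
        by (simp add: norm_mult norm_power mult_left_mono power_decreasing del: power_Suc)
    qed
    show "summable (\<lambda>n. norm (of_real (fps_nth ?F n) * z ^ n))"
      by (intro summable_norm_eval_disc summ z)
    show "summable (\<lambda>n. fps_nth ?F n * norm z ^ ?N)"
      using one by (intro summable_mult2) (simp add: sums_iff)
  qed
  also have "\<dots> = norm z ^ ?N"
    using sums_mult2[OF one, of "norm z ^ ?N"] by (simp add: sums_iff)
  finally show ?thesis .
qed

end

section \<open>Transfer to the complex polynomials and the iteration\<close>

lemma of_real_pochhammer:
  "of_real (pochhammer a n) = pochhammer (of_real a :: 'a::{real_algebra_1,comm_ring_1}) n"
  by (simp add: pochhammer_prod of_real_prod)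

lemma poly_pade_num: "poly (pade_num p k m) z = eval_disc (pade_fps (- (1 / real p)) m k) z"
  by (subst eval_disc_eq_sum[of k])
    (simp_all add: pade_fps_nth_eq_0, simp add: pade_num_def pade_fps_def poly_sum poly_monom
      of_real_pochhammer minus_diff_commute[of "of_nat m" "of_nat k"])

lemma poly_pade_den: "poly (pade_den p k m) z = eval_disc (pade_fps (1 / real p) k m) z"
  by (subst eval_disc_eq_sum[of m])
    (simp_all add: pade_fps_nth_eq_0, simp add: pade_den_def pade_fps_def poly_sum poly_monom
      of_real_pochhammer)

theorem mainTheorem1:
  fixes p k m :: nat and x :: "nat \<Rightarrow> complex"
  assumes "p \<ge> 2"
    and "int k \<ge> int m - 1"
    and "norm (1 - x 0 ^ p) < 1"
    and "\<And>l. x (Suc l) = x l * (poly (pade_num p k m) (1 - x l ^ p)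
                                 / poly (pade_den p k m) (1 - x l ^ p))"
  shows "\<forall>l. norm (1 - x l ^ p) \<le> norm (1 - x 0 ^ p) ^ ((k + m + 1) ^ l)"
proof
  fix l
  let ?a = "1 / real p" and ?r = "norm (1 - x 0 ^ p)"
  have a: "0 < ?a" "?a < 1" "real p * ?a = 1" using assms(1) by simp_all
  have m: "m \<le> Suc k" using assms(2) by linarith
  have step: "norm (1 - x (Suc l) ^ p) \<le> norm (1 - x l ^ p) ^ (k + m + 1)"
    if "norm (1 - x l ^ p) \<le> 1" for l
  proof -
    have "1 - x (Suc l) ^ p = eval_disc (residual ?a p k m) (1 - x l ^ p)"
      using eval_disc_residual[OF a(1,2) m that]
      by (simp add: assms(4) poly_pade_num poly_pade_den power_mult_distrib power_divide)
    then show ?thesis using norm_residual_le[OF a(1,2) m a(3) that] by simp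
  qed
  show "norm (1 - x l ^ p) \<le> ?r ^ ((k + m + 1) ^ l)"
  proof (induction l)
    case (Suc l)
    \<comment> \<open>With the induction hypothesis this keeps the current residual in the closed
      unit disc, where \<open>step\<close> applies.\<close>
    have "?r ^ ((k + m + 1) ^ l) \<le> 1" using assms(3) by (intro power_le_one) auto
    then have "norm (1 - x (Suc l) ^ p) \<le> norm (1 - x l ^ p) ^ (k + m + 1)"
      using Suc by (intro step) linarith
    also have "\<dots> \<le> (?r ^ ((k + m + 1) ^ l)) ^ (k + m + 1)"
      using Suc by (intro power_mono) auto
    also have "\<dots> = ?r ^ ((k + m + 1) ^ Suc l)"
      by (simp only: power_mult[symmetric] power_Suc2)
    finally show ?case .
  qed simp
qed

end
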